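(* Let $M \models \mathsf{UDLO}$ be separable. Then there is a definable set $D \subseteq M$ that has empty interior but is not compact.
   Context: A metric linear order is a set with a linear order $\le$ and metric $d$ such that every open ball is order-convex. $\mathsf{UDLO}$ is the theory of complete metric linear orders of diameter $\le 1$ with ultrametric metric such that for every $a$ both $\{d(a,b):b<a\}$ and $\{d(a,b):b>a\}$ are dense in $[0,1]$; in its models the metric and order topologies agree. A set $D\subseteq M$ is definable if it is nonempty, metrically closed, and $x\mapsto\inf_{y\in D}d(x,y)$ is a definable predicate (with parameters) in the language $\{d_\le,r\}$, where $r(x,y)=\inf_{z\le y}d(x,z)$. *)

theory Defs
  imports "HOL-Analysis.Analysis"
begin

text \<open>
  A structure is a type carrying both a linear order and a metric; the topology is that of the
  metric. Being a type, the underlying set is nonempty, as usual for metric structures.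
\<close>

definition metric_linear_order :: "'a::{linorder,metric_space} itself \<Rightarrow> bool" where
  "metric_linear_order _ \<longleftrightarrow>
     (\<forall>(c::'a) e x y z. x \<in> ball c e \<and> z \<in> ball c e \<and> x \<le> y \<and> y \<le> z \<longrightarrow> y \<in> ball c e)"

definition UDLO :: "'a::{linorder,complete_space} itself \<Rightarrow> bool" where
  "UDLO T \<longleftrightarrow>
     metric_linear_order T \<and>
     (\<forall>x y::'a. dist x y \<le> 1) \<and>
     (\<forall>x y z::'a. dist x z \<le> max (dist x y) (dist y z)) \<and>
     (\<forall>a::'a. {0..1} \<subseteq> closure {dist a b | b. b < a}) \<and>
     (\<forall>a::'a. {0..1} \<subseteq> closure {dist a b | b. a < b})"

text \<open>
  The predicate symbol \<open>d\<^sub>\<le>\<close> is read as the distance to the relation \<open>\<le>\<close>, the square of the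
  structure being equipped with the maximum metric (the product type of the library carries
  the Euclidean one, hence the explicit infimum).
\<close>

definition d_le :: "'a::{linorder,metric_space} \<Rightarrow> 'a \<Rightarrow> real" where
  "d_le x y = (INF p\<in>{p. fst p \<le> snd p}. max (dist x (fst p)) (dist y (snd p)))"

definition r_le :: "'a::{linorder,metric_space} \<Rightarrow> 'a \<Rightarrow> real" where
  "r_le x y = (INF z\<in>{..y}. dist x z)"

text \<open>
  Formulas of continuous logic over the language \<open>{d\<^sub>\<le>, r}\<close> with parameters from the structure;
  the metric is available as a logical symbol.
\<close>

datatype 'a cterm = Var nat | Param 'a

datatype 'a cformula =
    Dist "'a cterm" "'a cterm"
  | DLe "'a cterm" "'a cterm"
  | RLe "'a cterm" "'a cterm"
  | Conn "(nat \<Rightarrow> real) \<Rightarrow> real" "'a cformula list"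
  | SupQ nat "'a cformula"
  | InfQ nat "'a cformula"

text \<open>
  The cube \<open>[0,1]\<^sup>n\<close> is embedded in the space of real sequences (with the product topology) by
  padding with zeros. Connectives of arity \<open>n\<close> are the continuous maps from \<open>[0,1]\<^sup>n\<close>
  to \<open>[0,1]\<close>.
\<close>

definition unit_cube :: "nat \<Rightarrow> (nat \<Rightarrow> real) set" where
  "unit_cube n = {v. (\<forall>i<n. v i \<in> {0..1}) \<and> (\<forall>i\<ge>n. v i = 0)}"

definition connective :: "nat \<Rightarrow> ((nat \<Rightarrow> real) \<Rightarrow> real) \<Rightarrow> bool" where
  "connective n u \<longleftrightarrow> continuous_on (unit_cube n) u \<and> u ` unit_cube n \<subseteq> {0..1}"

primrec wf_cformula :: "'a cformula \<Rightarrow> bool" where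
  "wf_cformula (Dist s t) \<longleftrightarrow> True"
| "wf_cformula (DLe s t) \<longleftrightarrow> True"
| "wf_cformula (RLe s t) \<longleftrightarrow> True"
| "wf_cformula (Conn u \<phi>s) \<longleftrightarrow> connective (length \<phi>s) u \<and> list_all id (map wf_cformula \<phi>s)"
| "wf_cformula (SupQ i \<phi>) \<longleftrightarrow> wf_cformula \<phi>"
| "wf_cformula (InfQ i \<phi>) \<longleftrightarrow> wf_cformula \<phi>"

primrec fv_cterm :: "'a cterm \<Rightarrow> nat set" where
  "fv_cterm (Var i) = {i}"
| "fv_cterm (Param a) = {}"

primrec fv_cformula :: "'a cformula \<Rightarrow> nat set" where
  "fv_cformula (Dist s t) = fv_cterm s \<union> fv_cterm t"
| "fv_cformula (DLe s t) = fv_cterm s \<union> fv_cterm t"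
| "fv_cformula (RLe s t) = fv_cterm s \<union> fv_cterm t"
| "fv_cformula (Conn u \<phi>s) = \<Union> (set (map fv_cformula \<phi>s))"
| "fv_cformula (SupQ i \<phi>) = fv_cformula \<phi> - {i}"
| "fv_cformula (InfQ i \<phi>) = fv_cformula \<phi> - {i}"

primrec cterm_val :: "(nat \<Rightarrow> 'a) \<Rightarrow> 'a cterm \<Rightarrow> 'a" where
  "cterm_val \<sigma> (Var i) = \<sigma> i"
| "cterm_val \<sigma> (Param a) = a"

primrec cformula_val :: "'a::{linorder,metric_space} cformula \<Rightarrow> (nat \<Rightarrow> 'a) \<Rightarrow> real" where
  "cformula_val (Dist s t) = (\<lambda>\<sigma>. dist (cterm_val \<sigma> s) (cterm_val \<sigma> t))"
| "cformula_val (DLe s t) = (\<lambda>\<sigma>. d_le (cterm_val \<sigma> s) (cterm_val \<sigma> t))"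
| "cformula_val (RLe s t) = (\<lambda>\<sigma>. r_le (cterm_val \<sigma> s) (cterm_val \<sigma> t))"
| "cformula_val (Conn u \<phi>s) =
     (\<lambda>\<sigma>. u (\<lambda>i. if i < length \<phi>s then (map cformula_val \<phi>s ! i) \<sigma> else 0))"
| "cformula_val (SupQ i \<phi>) = (\<lambda>\<sigma>. SUP a. cformula_val \<phi> (\<sigma>(i := a)))"
| "cformula_val (InfQ i \<phi>) = (\<lambda>\<sigma>. INF a. cformula_val \<phi> (\<sigma>(i := a)))"

text \<open>
  A definable predicate is a uniform limit of interpretations of formulas with parameters. In
  the unary case the only free variable is number \<open>0\<close>, so the constant assignment can be used.
\<close>

definition definable_predicate :: "('a::{linorder,metric_space} \<Rightarrow> real) \<Rightarrow> bool" where
  "definable_predicate P \<longleftrightarrow>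
     (\<exists>\<phi> :: nat \<Rightarrow> 'a cformula.
        (\<forall>k. wf_cformula (\<phi> k) \<and> fv_cformula (\<phi> k) \<subseteq> {0}) \<and>
        uniform_limit UNIV (\<lambda>k x. cformula_val (\<phi> k) (\<lambda>_. x)) P sequentially)"

definition definable_set :: "'a::{linorder,metric_space} set \<Rightarrow> bool" where
  "definable_set D \<longleftrightarrow>
     D \<noteq> {} \<and> closed D \<and> definable_predicate (\<lambda>x. INF y\<in>D. dist x y)"

end

theory Submission
  imports Defs
begin

text \<open>
  Balls are convex, so \<open>r(x, a)\<close> is \<open>0\<close> for \<open>x \<le> a\<close> and \<open>d(x, a)\<close> otherwise. Hence the distance
  to the complement of an open interval \<open>(a, b)\<close> is \<open>min (r(x, a)) (r(b, x))\<close>. As in the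
  construction of the Cantor set, let \<open>D\<close> be the complement of a countable family of open
  intervals with dense union, such that the corresponding closed intervals are disjoint and
  \<open>d(a, b)\<close> tends to \<open>0\<close> along the family. The distance to \<open>D\<close> is then the uniform limit of
  the finite maxima of the distances above. If all \<open>d(a, b)\<close> are less than \<open>1/2\<close>, every point is
  at distance less than \<open>1/2\<close> from \<open>D\<close>, so compactness of \<open>D\<close> would give a finite cover of the
  whole space by balls of radius \<open>1/2\<close>. A point would then have only finitely many distances
  above \<open>1/2\<close> to other points, but these are dense in \<open>[1/2, 1]\<close>.
\<close>

section \<open>Distances and topology in a metric linear order\<close>

lemma metric_linear_orderD:
  fixes x y z :: "'a::{linorder,metric_space}"
  assumes "metric_linear_order TYPE('a)" "x \<le> y" "y \<le> z"
  shows "dist x y \<le> dist x z" and "dist y z \<le> dist x z"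
proof -
  have conv: "y \<in> ball c e" if "x \<in> ball c e" "z \<in> ball c e" for c e
    using assms that unfolding metric_linear_order_def by blast
  show "dist x y \<le> dist x z"
  proof (rule ccontr)
    assume "\<not> dist x y \<le> dist x z"
    \<comment> \<open>This open ball contains \<open>x\<close> and \<open>z\<close>, while
      \<open>y\<close> is exactly its radius away from the centre, against convexity. The second
      inequality uses a ball about \<open>z\<close> in the same way.\<close>
    then have "x \<in> ball x (dist x y)" "z \<in> ball x (dist x y)"
      using zero_le_dist[of x z] by (auto simp: mem_ball simp del: zero_le_dist)
    from conv[OF this] show False
      by simp
  qed
  show "dist y z \<le> dist x z"
  proof (rule ccontr)
    assume "\<not> dist y z \<le> dist x z"
    then have "x \<in> ball z (dist y z)" "z \<in> ball z (dist y z)"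
      using zero_le_dist[of x z] by (auto simp: mem_ball dist_commute simp del: zero_le_dist)
    from conv[OF this] show False
      by (simp add: dist_commute)
  qed
qed

text \<open>If \<open>y < x\<close>, then \<open>y\<close> lies between \<open>x\<close> and every
  other point of \<open>{..y}\<close>, so convexity makes it a nearest one and the infimum is
  attained.\<close>

lemma r_le_eq:
  fixes x y :: "'a::{linorder,metric_space}"
  assumes "metric_linear_order TYPE('a)"
  shows "r_le x y = (if x \<le> y then 0 else dist x y)"
  unfolding r_le_def
proof (rule cInf_eq_minimum)
  show "(if x \<le> y then 0 else dist x y) \<in> dist x ` {..y}"
    by (auto intro: image_eqI[of _ _ x])
  show "(if x \<le> y then 0 else dist x y) \<le> w" if "w \<in> dist x ` {..y}" for w
    using that metric_linear_orderD(2)[OF assms, of _ y x] by (auto simp: dist_commute)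
qed

text \<open>The radius \<open>dist x a\<close> works at \<open>x\<close>: a point
  \<open>y \<le> a\<close> has \<open>a\<close> between itself and \<open>x\<close>, so it is at
  least that far from \<open>x\<close>.\<close>

lemma open_greaterThan_metric_linear_order:
  fixes a :: "'a::{linorder,metric_space}"
  assumes "metric_linear_order TYPE('a)"
  shows "open {a<..}"
  unfolding open_dist
proof (intro ballI exI conjI allI impI)
  fix x assume x: "x \<in> {a<..}"
  then show "0 < dist x a" by simp
  fix y assume "dist y x < dist x a"
  then show "y \<in> {a<..}"
    using x metric_linear_orderD(2)[OF assms, of y a x] by (force simp: dist_commute not_less)
qed

lemma open_lessThan_metric_linear_order:
  fixes a :: "'a::{linorder,metric_space}"
  assumes "metric_linear_order TYPE('a)"
  shows "open {..<a}"
  unfolding open_dist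
proof (intro ballI exI conjI allI impI)
  fix x assume x: "x \<in> {..<a}"
  then show "0 < dist x a" by simp
  fix y assume "dist y x < dist x a"
  then show "y \<in> {..<a}"
    using x metric_linear_orderD(1)[OF assms, of x a y] by (force simp: dist_commute not_less)
qed

lemma open_greaterThanLessThan_metric_linear_order:
  fixes a b :: "'a::{linorder,metric_space}"
  assumes "metric_linear_order TYPE('a)"
  shows "open {a<..<b}"
  unfolding greaterThanLessThan_def
  by (intro open_Int open_greaterThan_metric_linear_order
      open_lessThan_metric_linear_order assms)

lemma closed_atLeastAtMost_metric_linear_order:
  fixes a b :: "'a::{linorder,metric_space}"
  assumes "metric_linear_order TYPE('a)"
  shows "closed {a..b}"
proof -
  have "- {a..b} = {..<a} \<union> {b<..}"
    by auto
  then show ?thesis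
    unfolding closed_def
    by (simp add: open_Un open_greaterThan_metric_linear_order
        open_lessThan_metric_linear_order assms)
qed

section \<open>Consequences of the ultrametric and density axioms\<close>

lemma UDLO_metric_linear_order:
  "UDLO TYPE('a::{linorder,complete_space}) \<Longrightarrow> metric_linear_order TYPE('a)"
  by (simp add: UDLO_def)

lemma UDLO_ultrametric:
  fixes x y z :: "'a::{linorder,complete_space}"
  shows "UDLO TYPE('a) \<Longrightarrow> dist x z \<le> max (dist x y) (dist y z)"
  by (simp add: UDLO_def)

lemma UDLO_greater_near:
  fixes a :: "'a::{linorder,complete_space}"
  assumes "UDLO TYPE('a)" "e > 0"
  obtains b where "a < b" "dist a b < e"
proof -
  have "0 \<in> closure {dist a b | b. a < b}"
    using assms(1) unfolding UDLO_def by force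
  with assms(2) that show thesis
    by (force simp: closure_approachable dist_real_def)
qed

lemma UDLO_less_near:
  fixes a :: "'a::{linorder,complete_space}"
  assumes "UDLO TYPE('a)" "e > 0"
  obtains b where "b < a" "dist a b < e"
proof -
  have "0 \<in> closure {dist a b | b. b < a}"
    using assms(1) unfolding UDLO_def by force
  with assms(2) that show thesis
    by (force simp: closure_approachable dist_real_def)
qed

lemma UDLO_closure_greaterThanLessThan:
  fixes a b :: "'a::{linorder,complete_space}"
  assumes U: "UDLO TYPE('a)" and "a < b"
  shows "{a..b} \<subseteq> closure {a<..<b}"
proof
  note ord = metric_linear_orderD[OF UDLO_metric_linear_order[OF U]]
  fix x assume x: "x \<in> {a..b}"
  consider "x \<in> {a<..<b}" | "x = a" | "x = b"
    using x by fastforce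
  then show "x \<in> closure {a<..<b}"
  proof cases
    case 1
    then show ?thesis
      using closure_subset by blast
  next
    case 2
    show ?thesis
      unfolding closure_approachable
    proof (intro allI impI)
      fix e :: real assume "e > 0"
      \<comment> \<open>Points at or beyond \<open>b\<close> are at distance at least
        \<open>dist a b\<close> from \<open>a\<close>, so a point right of \<open>a\<close> and
        nearer than that stays inside the interval.\<close>
      then have "min e (dist a b) > 0"
        using \<open>a < b\<close> by simp
      then obtain c where "a < c" "dist a c < min e (dist a b)"
        using UDLO_greater_near[OF U] by blast
      moreover from this have "c < b"
        using ord(1)[of a b c] \<open>a < b\<close> by (meson less_imp_le min_less_iff_conj not_le)
      ultimately show "\<exists>y\<in>{a<..<b}. dist y x < e"
        using 2 by (intro bexI[of _ c]) (simp_all add: dist_commute)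
    qed
  next
    case 3
    show ?thesis
      unfolding closure_approachable
    proof (intro allI impI)
      fix e :: real assume "e > 0"
      then have "min e (dist a b) > 0"
        using \<open>a < b\<close> by simp
      then obtain c where "c < b" "dist b c < min e (dist a b)"
        using UDLO_less_near[OF U] by blast
      moreover from this have "a < c"
        using ord(2)[of c a b] \<open>a < b\<close>
        by (metis dist_commute less_imp_le min_less_iff_conj not_le)
      ultimately show "\<exists>y\<in>{a<..<b}. dist y x < e"
        using 3 by (intro bexI[of _ c]) (simp_all add: dist_commute)
    qed
  qed
qed

text \<open>Ultrametric triangles are isosceles: if \<open>dist a b > 1/2\<close> and
  \<open>dist c b < 1/2\<close>, then \<open>dist a b = dist a c\<close>. A finite set of centres
  thus allows finitely many distances from \<open>a\<close> above 1/2. Together with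
  \<open>{..1/2}\<close> they form a closed set, which by density would contain all of
  \<open>{0..1}\<close>.\<close>

lemma UDLO_not_finite_half_cover:
  assumes U: "UDLO TYPE('a::{linorder,complete_space})" and "finite (C :: 'a set)"
  shows "(\<Union>c\<in>C. ball c (1/2)) \<noteq> UNIV"
proof
  assume cover: "(\<Union>c\<in>C. ball c (1/2)) = UNIV"
  fix a :: 'a
  have "{dist a b | b. a < b} \<subseteq> {..1/2} \<union> dist a ` C"
  proof clarify
    fix b
    assume "dist a b \<notin> dist a ` C"
    obtain c where c: "c \<in> C" "dist c b < 1/2"
      using cover by (metis UNIV_I UN_E mem_ball)
    show "dist a b \<le> 1/2"
      using UDLO_ultrametric[OF U, of a b c] UDLO_ultrametric[OF U, of a c b]
        c \<open>dist a b \<notin> dist a ` C\<close> by (force simp: dist_commute max_def split: if_splits)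
  qed
  moreover have "closed ({..1/2} \<union> dist a ` C)"
    using assms(2) by (simp add: closed_Un finite_imp_closed)
  ultimately have "closure {dist a b | b. a < b} \<subseteq> {..1/2} \<union> dist a ` C"
    by (rule closure_minimal)
  moreover have "{0..1} \<subseteq> closure {dist a b | b. a < b}"
    using U by (simp add: UDLO_def)
  ultimately have "{0..1} \<subseteq> {..1/2} \<union> dist a ` C"
    by (rule order_trans[rotated])
  moreover have "{1/2<..1::real} \<subseteq> {0..1} - {..1/2}"
    by auto
  ultimately have "{1/2<..1} \<subseteq> dist a ` C"
    by blast
  then have "finite {1/2<..1::real}"
    using assms(2) finite_subset by blast
  then show False
    using infinite_Ioc[of "1/2::real" 1] by simp
qed

section \<open>Formulas for finite families of intervals\<close>

lemma connective_max: "connective (Suc (Suc 0)) (\<lambda>v. max (v 0) (v (Suc 0)))"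
  unfolding connective_def
proof
  show "continuous_on (unit_cube (Suc (Suc 0))) (\<lambda>v. max (v 0) (v (Suc 0)))"
    by (intro continuous_on_max continuous_on_subset[OF continuous_on_product_coordinates subset_UNIV])
qed (auto simp: unit_cube_def le_max_iff_disj)

lemma connective_min: "connective (Suc (Suc 0)) (\<lambda>v. min (v 0) (v (Suc 0)))"
  unfolding connective_def
proof
  show "continuous_on (unit_cube (Suc (Suc 0))) (\<lambda>v. min (v 0) (v (Suc 0)))"
    by (intro continuous_on_min continuous_on_subset[OF continuous_on_product_coordinates subset_UNIV])
qed (auto simp: unit_cube_def min_le_iff_disj)

definition interval_gap :: "'a::{linorder,metric_space} \<Rightarrow> 'a \<times> 'a \<Rightarrow> real" where
  "interval_gap x p = min (r_le x (fst p)) (r_le (snd p) x)"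

lemma interval_gap_eq:
  fixes x :: "'a::{linorder,metric_space}"
  assumes "metric_linear_order TYPE('a)"
  shows "interval_gap x (a, b) = (if x \<in> {a<..<b} then min (dist x a) (dist x b) else 0)"
  by (auto simp: interval_gap_def r_le_eq[OF assms] dist_commute)

text \<open>The empty family needs the constant 0, which is written as the distance from the
  variable to itself. It is also the source of the 0 inserted in the maxima below.\<close>

primrec interval_gaps_formula :: "('a \<times> 'a) list \<Rightarrow> 'a cformula" where
  "interval_gaps_formula [] = Dist (Var 0) (Var 0)"
| "interval_gaps_formula (p # ps) =
     Conn (\<lambda>v. max (v 0) (v (Suc 0)))
       [Conn (\<lambda>v. min (v 0) (v (Suc 0)))
          [RLe (Var 0) (Param (fst p)), RLe (Param (snd p)) (Var 0)],
        interval_gaps_formula ps]"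

lemma wf_interval_gaps_formula: "wf_cformula (interval_gaps_formula ps)"
  by (induction ps) (simp_all add: connective_max connective_min)

lemma fv_interval_gaps_formula: "fv_cformula (interval_gaps_formula ps) \<subseteq> {0}"
  by (induction ps) simp_all

lemma interval_gaps_formula_val:
  "cformula_val (interval_gaps_formula ps) (\<lambda>_. x) = Max (insert 0 (interval_gap x ` set ps))"
proof (induction ps)
  case (Cons p ps)
  have "Max (insert 0 (interval_gap x ` set (p # ps))) =
      Max (insert (interval_gap x p) (insert 0 (interval_gap x ` set ps)))"
    by (simp add: insert_commute)
  also have "\<dots> = max (interval_gap x p) (Max (insert 0 (interval_gap x ` set ps)))"
    by (rule Max_insert) simp_all
  finally show ?case
    by (simp add: Cons.IH interval_gap_def)
qed simp

lemma definable_predicate_interval_gaps: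
  fixes S :: "nat \<Rightarrow> ('a::{linorder,metric_space} \<times> 'a) set"
  assumes "\<And>n. finite (S n)"
    and "uniform_limit UNIV (\<lambda>n x. Max (insert 0 (interval_gap x ` S n))) P sequentially"
  shows "definable_predicate P"
proof -
  obtain ps where ps: "\<And>n. set (ps n) = S n"
    using finite_list[OF assms(1)] by metis
  show ?thesis
    unfolding definable_predicate_def
    by (rule exI[of _ "\<lambda>n. interval_gaps_formula (ps n)"])
      (use assms(2) in \<open>simp add: interval_gaps_formula_val ps
          wf_interval_gaps_formula fv_interval_gaps_formula\<close>)
qed

section \<open>Complements of families of disjoint intervals\<close>

definition disjoint_intervals :: "('a::linorder \<times> 'a) set \<Rightarrow> bool" where
  "disjoint_intervals I \<longleftrightarrow>
     (\<forall>(a, b)\<in>I. a < b) \<and> pairwise (\<lambda>(a, b) (c, d). {a..b} \<inter> {c..d} = {}) I"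

text \<open>Open intervals are removed, whereas \<open>disjoint_intervals\<close> speaks of closed
  ones. This keeps all end points in the complement, where they serve as nearest points.\<close>

definition interval_complement :: "('a::linorder \<times> 'a) set \<Rightarrow> 'a set" where
  "interval_complement I = - (\<Union>(a, b)\<in>I. {a<..<b})"

lemma disjoint_intervals_unique:
  assumes "disjoint_intervals I" "(a, b) \<in> I" "(c, d) \<in> I" "x \<in> {a..b}" "x \<in> {c..d}"
  shows "a = c \<and> b = d"
proof (rule ccontr)
  assume "\<not> (a = c \<and> b = d)"
  then have "{a..b} \<inter> {c..d} = {}"
    using assms(1-3) unfolding disjoint_intervals_def
    by (auto dest!: pairwiseD[where x = "(a, b)" and y = "(c, d)"])
  with assms(4,5) show False
    by blast
qed

lemma endpoints_in_interval_complement: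
  assumes "disjoint_intervals I" "(a, b) \<in> I"
  shows "a \<in> interval_complement I" "b \<in> interval_complement I"
proof -
  have "a < b"
    using assms by (auto simp: disjoint_intervals_def)
  then show "a \<in> interval_complement I" "b \<in> interval_complement I"
    using disjoint_intervals_unique[OF assms, of _ _ a] disjoint_intervals_unique[OF assms, of _ _ b]
    by (fastforce simp: interval_complement_def)+
qed

text \<open>A point of the complement lies at or left of \<open>a\<close>, or at or right of
  \<open>b\<close>. By convexity the end point on that side is at least as near to \<open>x\<close>,
  and both end points belong to the complement.\<close>

lemma infdist_interval_complement:
  fixes x :: "'a::{linorder,metric_space}"
  assumes M: "metric_linear_order TYPE('a)" and I: "disjoint_intervals I" "(a, b) \<in> I"
    and x: "x \<in> {a<..<b}"
  shows "(INF y\<in>interval_complement I. dist x y) = interval_gap x (a, b)"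
proof (rule cInf_eq_minimum)
  show "interval_gap x (a, b) \<in> dist x ` interval_complement I"
    using endpoints_in_interval_complement[OF I] x
    by (auto simp: interval_gap_eq[OF M] min_def)
  fix w assume "w \<in> dist x ` interval_complement I"
  then obtain y where y: "w = dist x y" "y \<in> interval_complement I"
    by blast
  then have "y \<le> a \<or> b \<le> y"
    using I by (force simp: interval_complement_def)
  then have "dist x a \<le> w \<or> dist x b \<le> w"
    using x y metric_linear_orderD(2)[OF M, of y a x] metric_linear_orderD(1)[OF M, of x b y]
    by (metis dist_commute greaterThanLessThan_iff less_imp_le)
  then show "interval_gap x (a, b) \<le> w"
    using x by (simp add: interval_gap_eq[OF M] min_le_iff_disj)
qed

text \<open>The maximum over \<open>S n\<close> agrees with the distance to the complement except
  inside intervals outside \<open>S n\<close>. There the error is at most the distance of the end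
  points, so \<open>small\<close> gives uniform convergence.\<close>

lemma definable_set_interval_complement:
  fixes S :: "nat \<Rightarrow> ('a::{linorder,metric_space} \<times> 'a) set"
  assumes M: "metric_linear_order TYPE('a)" and fin: "\<And>n. finite (S n)"
    and I: "disjoint_intervals I" and I_Un: "I = (\<Union>n. S n)"
    and ne: "interval_complement I \<noteq> {}"
    and small: "\<And>n a b. (a, b) \<in> I - S n \<Longrightarrow> dist a b \<le> 1 / Suc n"
  shows "definable_set (interval_complement I)"
proof -
  let ?P = "\<lambda>x. INF y\<in>interval_complement I. dist x y"
  have "closed (interval_complement I)"
    unfolding interval_complement_def
    by (auto simp: closed_def intro!: open_greaterThanLessThan_metric_linear_order M)
  moreover have "definable_predicate ?P"
  proof (rule definable_predicate_interval_gaps[OF fin])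
    have close: "dist (Max (insert 0 (interval_gap x ` S n))) (?P x) \<le> 1 / Suc n" for n x
    proof (cases "x \<in> interval_complement I")
      case True
      then have "insert 0 (interval_gap x ` S n) = {0}"
        using I_Un by (force simp: interval_gap_eq[OF M] interval_complement_def)
      moreover have "?P x = 0"
        by (rule cInf_eq_minimum) (use True in \<open>auto intro: image_eqI[of _ _ x]\<close>)
      ultimately show ?thesis
        by (simp only: Max_singleton dist_self) simp
    next
      case False
      then obtain a b where ab: "(a, b) \<in> I" "x \<in> {a<..<b}"
        by (auto simp: interval_complement_def)
      have P: "?P x = interval_gap x (a, b)"
        by (rule infdist_interval_complement[OF M I ab])
      \<comment> \<open>By disjointness \<open>(a, b)\<close> is the only interval around
        \<open>x\<close>, so the finite maximum has at most one nonzero term.\<close>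
      have zero: "interval_gap x p = 0" if "p \<in> S n" "p \<noteq> (a, b)" for p
      proof -
        obtain c d where "p = (c, d)" by fastforce
        moreover from this have "x \<notin> {c<..<d}"
          using disjoint_intervals_unique[OF I ab(1), of c d x] that ab(2) I_Un
          by fastforce
        ultimately show ?thesis
          by (simp only: interval_gap_eq[OF M] if_False)
      qed
      have nonneg: "0 \<le> interval_gap x (a, b)"
        by (simp add: interval_gap_eq[OF M])
      show ?thesis
      proof (cases "(a, b) \<in> S n")
        case True
        have "Max (insert 0 (interval_gap x ` S n)) = interval_gap x (a, b)"
          by (rule Max_eqI) (use fin zero nonneg True in \<open>auto, metis order_refl\<close>)
        then show ?thesis
          by (simp add: P)
      next
        case False
        \<comment> \<open>The interval around \<open>x\<close> is not listed at stage
          \<open>n\<close>: the approximation is 0 and the error is the gap itself, bounded by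
          \<open>dist a b\<close> through convexity.\<close>
        then have "insert 0 (interval_gap x ` S n) = {0}"
          using zero by force
        then have "Max (insert 0 (interval_gap x ` S n)) = 0"
          by (simp only: Max_singleton)
        moreover have "interval_gap x (a, b) \<le> dist a b"
          using ab(2) metric_linear_orderD(1)[OF M, of a x b] less_imp_le[of a x] less_imp_le[of x b]
          by (simp add: interval_gap_eq[OF M] dist_commute min_le_iff_disj)
        ultimately show ?thesis
          using small[of a b n] False ab(1) nonneg P by (simp add: dist_real_def)
      qed
    qed
    show "uniform_limit UNIV (\<lambda>n x. Max (insert 0 (interval_gap x ` S n))) ?P sequentially"
    proof (rule uniform_limitI)
      fix e :: real assume "e > 0"
      then have "\<forall>\<^sub>F n in sequentially. 1 / Suc n < e"
        using order_tendstoD(2)[OF LIMSEQ_inverse_real_of_nat] by (simp add: inverse_eq_divide)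
      then show "\<forall>\<^sub>F n in sequentially. \<forall>x\<in>UNIV.
          dist (Max (insert 0 (interval_gap x ` S n))) (?P x) < e"
        by (rule eventually_mono) (use close le_less_trans in blast)
    qed
  qed
  ultimately show ?thesis
    using ne by (simp add: definable_set_def)
qed

section \<open>Construction of the intervals\<close>

lemma UDLO_interval_right_of:
  fixes m :: "'a::{linorder,complete_space}"
  assumes U: "UDLO TYPE('a)" and "finite S" and m: "m \<notin> (\<Union>(a, b)\<in>S. {a..b})" and "e > 0"
  obtains b where "m < b" "dist m b < e" "\<And>c d. (c, d) \<in> S \<Longrightarrow> {m..b} \<inter> {c..d} = {}"
proof -
  note M = UDLO_metric_linear_order[OF U]
  \<comment> \<open>A finite union of closed intervals is closed, so some ball about
    \<open>m\<close> avoids it. Convexity keeps \<open>{m..b}\<close> in that ball once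
    \<open>b\<close> is in it.\<close>
  have "closed (\<Union>(a, b)\<in>S. {a..b})"
    using \<open>finite S\<close> by (auto intro!: closed_UN closed_atLeastAtMost_metric_linear_order M)
  then obtain r where r: "r > 0" "ball m r \<inter> (\<Union>(a, b)\<in>S. {a..b}) = {}"
    using m by (metis ComplI closed_def disjoint_eq_subset_Compl open_contains_ball_eq)
  obtain b where b: "m < b" "dist m b < min e r"
    using UDLO_greater_near[OF U, of "min e r"] \<open>e > 0\<close> r(1) by auto
  have "{m..b} \<subseteq> ball m r"
    using metric_linear_orderD(1)[OF M, of m _ b] b by force
  then have "{m..b} \<inter> {c..d} = {}" if "(c, d) \<in> S" for c d
    using r(2) that by blast
  with b show thesis
    by (intro that) auto
qed

text \<open>A greedy recursion: stage \<open>n\<close> leaves the family alone if \<open>m n\<close>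
  is already covered, and otherwise adds a short interval with left end \<open>m n\<close>. For a
  dense sequence \<open>m\<close> the union of the intervals is then dense.\<close>

lemma UDLO_dense_interval_family:
  fixes m :: "nat \<Rightarrow> 'a::{linorder,complete_space}"
  assumes U: "UDLO TYPE('a)"
  obtains S :: "nat \<Rightarrow> ('a \<times> 'a) set" where
    "\<And>n. finite (S n)" "disjoint_intervals (\<Union>n. S n)"
    "\<And>n. m n \<in> (\<Union>(a, b)\<in>\<Union>n. S n. {a..b})"
    "\<And>n a b. (a, b) \<in> (\<Union>n. S n) - S n \<Longrightarrow> dist a b < 1 / Suc n"
    "\<And>a b. (a, b) \<in> (\<Union>n. S n) \<Longrightarrow> dist a b < 1 / 2"
proof -
  \<comment> \<open>\<open>P\<close> is the invariant of a stage, \<open>Q\<close> the relation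
    between consecutive stages. The bound \<open>1 / Suc (Suc n)\<close> on new intervals is at most
    1/2 even for \<open>n = 0\<close>, so adding them preserves the last clause of
    \<open>P\<close>.\<close>
  define P where "P n S \<longleftrightarrow> finite S \<and> disjoint_intervals S \<and>
      (\<forall>(a, b)\<in>S. dist a b < 1 / 2)" for n :: nat and S :: "('a \<times> 'a) set"
  define Q where "Q n S T \<longleftrightarrow> S \<subseteq> T \<and> m n \<in> (\<Union>(a, b)\<in>T. {a..b}) \<and>
      (\<forall>(a, b)\<in>T - S. dist a b < 1 / Suc (Suc n))" for n :: nat and S T :: "('a \<times> 'a) set"
  have "\<exists>S. P 0 S"
    by (rule exI[of _ "{}"]) (simp add: P_def disjoint_intervals_def)
  moreover have "\<exists>T. P (Suc n) T \<and> Q n S T" if S: "P n S" for n S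
  proof (cases "m n \<in> (\<Union>(a, b)\<in>S. {a..b})")
    case True
    with S show ?thesis
      by (intro exI[of _ S]) (auto simp: P_def Q_def)
  next
    case False
    obtain b where b: "m n < b" "dist (m n) b < 1 / Suc (Suc n)"
      "\<And>c d. (c, d) \<in> S \<Longrightarrow> {m n..b} \<inter> {c..d} = {}"
      using UDLO_interval_right_of[OF U _ False, of "1 / Suc (Suc n)"] S
      unfolding P_def by (metis of_nat_0_less_iff zero_less_Suc zero_less_divide_1_iff)
    have "1 / real (Suc (Suc n)) \<le> 1 / 2"
      by (simp add: field_simps)
    with b(2) have "dist (m n) b < 1 / 2"
      by linarith
    moreover have "disjoint_intervals (insert (m n, b) S)"
      using S b(1,3) unfolding P_def disjoint_intervals_def
      by (auto simp: pairwise_insert Int_commute)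
    ultimately show ?thesis
      using S b by (intro exI[of _ "insert (m n, b) S"]) (auto simp: P_def Q_def)
  qed
  ultimately obtain S where S: "\<And>n. P n (S n)" "\<And>n. Q n (S n) (S (Suc n))"
    using dependent_nat_choice[of P Q] by metis
  have mono: "S i \<subseteq> S j" if "i \<le> j" for i j
    using lift_Suc_mono_le[of S i j] S(2) that by (simp add: Q_def)
  show thesis
  proof (rule that[of S])
    show "finite (S n)" for n
      using S(1) by (simp add: P_def)
    show "m n \<in> (\<Union>(a, b)\<in>\<Union>n. S n. {a..b})" for n
      using S(2)[of n] by (fastforce simp: Q_def)
    show "dist a b < 1 / 2" if "(a, b) \<in> (\<Union>n. S n)" for a b
      using S(1) that by (fastforce simp: P_def)
    show "disjoint_intervals (\<Union>n. S n)"
      unfolding disjoint_intervals_def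
    proof
      show "\<forall>(a, b)\<in>\<Union>n. S n. a < b"
        using S(1) by (fastforce simp: P_def disjoint_intervals_def)
      show "pairwise (\<lambda>(a, b) (c, d). {a..b} \<inter> {c..d} = {}) (\<Union>n. S n)"
      proof (rule pairwiseI)
        fix p q assume "p \<in> (\<Union>n. S n)" "q \<in> (\<Union>n. S n)" and "p \<noteq> q"
        then obtain i j where "p \<in> S i" "q \<in> S j"
          by blast
        then have "p \<in> S (max i j)" "q \<in> S (max i j)"
          using mono[of i "max i j"] mono[of j "max i j"] by auto
        with \<open>p \<noteq> q\<close> show "(\<lambda>(a, b) (c, d). {a..b} \<inter> {c..d} = {}) p q"
          using S(1)[of "max i j"] unfolding P_def disjoint_intervals_def
          by (blast dest: pairwiseD)
      qed
    qed
    show "dist a b < 1 / Suc n" if ab: "(a, b) \<in> (\<Union>n. S n) - S n" for n a b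
    proof -
      obtain k where "(a, b) \<in> S k"
        using ab by blast
      then have "n \<le> k"
        using mono[of k n] ab by (meson DiffD2 nle_le subsetD)
      \<comment> \<open>As an implication the claim suits induction from \<open>n\<close>: the base
        case is vacuous because the interval is not in \<open>S n\<close>. In the step it either was
        present already or is new and obeys the bound in \<open>Q\<close>.\<close>
      then have "(a, b) \<in> S k \<longrightarrow> dist a b < 1 / Suc n"
      proof (induction k rule: dec_induct)
        case base
        then show ?case
          using ab by simp
      next
        case (step k)
        have "1 / real (Suc (Suc k)) < 1 / Suc n"
          using step.hyps by (simp add: field_simps)
        then show ?case
          using step.IH S(2)[of k] unfolding Q_def by force
      qed
      with \<open>(a, b) \<in> S k\<close> show ?thesis
        by blast
    qed
  qed
qed

section \<open>Non-compactness and empty interior\<close>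

lemma UDLO_interval_complement_not_compact:
  fixes I :: "('a::{linorder,complete_space} \<times> 'a) set"
  assumes U: "UDLO TYPE('a)" and I: "disjoint_intervals I"
    and small: "\<And>a b. (a, b) \<in> I \<Longrightarrow> dist a b < 1 / 2"
  shows "\<not> compact (interval_complement I)"
proof
  note M = UDLO_metric_linear_order[OF U]
  assume "compact (interval_complement I)"
  then obtain C where C: "finite C" "interval_complement I \<subseteq> (\<Union>c\<in>C. ball c (1/2))"
    using compact_eq_totally_bounded[of "interval_complement I"]
    by (metis half_gt_zero_iff zero_less_one)
  have "x \<in> (\<Union>c\<in>C. ball c (1/2))" for x
  proof -
    \<comment> \<open>A removed point is near the left end of its interval. The ultrametric
      inequality then lets the balls covering the complement cover the whole space without enlarging
      the radius 1/2.\<close>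
    have "\<exists>y\<in>interval_complement I. dist y x < 1/2"
    proof (cases "x \<in> interval_complement I")
      case True
      then show ?thesis
        by (intro bexI[of _ x]) simp_all
    next
      case False
      then obtain a b where ab: "(a, b) \<in> I" "a < x" "x < b"
        by (auto simp: interval_complement_def)
      then have "dist a x < 1/2"
        using small[OF ab(1)] metric_linear_orderD(1)[OF M, of a x b]
        by (meson le_less_trans less_imp_le)
      then show ?thesis
        using endpoints_in_interval_complement(1)[OF I ab(1)] by blast
    qed
    then obtain y c where "dist y x < 1/2" "c \<in> C" "dist c y < 1/2"
      using C(2) by fastforce
    then show ?thesis
      using UDLO_ultrametric[OF U, of c x y] by (intro UN_I[of c]) auto
  qed
  with UDLO_not_finite_half_cover[OF U C(1)] show False
    by blast
qed

text \<open>End points are limits of interior points of their intervals, so density of the closed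
  intervals passes to the open ones, and the complement of a dense set has empty interior.\<close>

lemma UDLO_interior_interval_complement:
  fixes I :: "('a::{linorder,complete_space} \<times> 'a) set"
  assumes U: "UDLO TYPE('a)" and I: "disjoint_intervals I"
    and dense: "closure (\<Union>(a, b)\<in>I. {a..b}) = UNIV"
  shows "interior (interval_complement I) = {}"
proof -
  have "(\<Union>(a, b)\<in>I. {a..b}) \<subseteq> closure (\<Union>(a, b)\<in>I. {a<..<b})"
  proof clarify
    fix a b x assume ab: "(a, b) \<in> I" and x: "x \<in> {a..b}"
    have "a < b"
      using ab I by (auto simp: disjoint_intervals_def)
    then have "x \<in> closure {a<..<b}"
      using x UDLO_closure_greaterThanLessThan[OF U] by blast
    moreover have "{a<..<b} \<subseteq> (\<Union>(a, b)\<in>I. {a<..<b})"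
      using ab by blast
    ultimately show "x \<in> closure (\<Union>(a, b)\<in>I. {a<..<b})"
      using closure_mono by blast
  qed
  then have "closure (\<Union>(a, b)\<in>I. {a<..<b}) = UNIV"
    using dense closure_minimal[OF _ closed_closure] by blast
  then show ?thesis
    by (simp add: interval_complement_def interior_closure)
qed

theorem theorem7p13:
  assumes "UDLO TYPE('a::{linorder,complete_space})"
    and "separable_space (euclidean :: 'a topology)"
  shows "\<exists>D :: 'a set. definable_set D \<and> interior D = {} \<and> \<not> compact D"
proof -
  obtain C :: "'a set" where C: "countable C" "closure C = UNIV"
    using assms(2) by (auto simp: separable_space_def)
  then have "C \<noteq> {}"
    by auto
  define m where "m = from_nat_into C"
  have m: "range m = C"
    unfolding m_def using C(1) \<open>C \<noteq> {}\<close> by (rule range_from_nat_into[rotated])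
  obtain S where S: "\<And>n. finite (S n)" "disjoint_intervals (\<Union>n. S n)"
    "\<And>n. m n \<in> (\<Union>(a, b)\<in>\<Union>n. S n. {a..b})"
    "\<And>n a b. (a, b) \<in> (\<Union>n. S n) - S n \<Longrightarrow> dist a b < 1 / Suc n"
    "\<And>a b. (a, b) \<in> (\<Union>n. S n) \<Longrightarrow> dist a b < 1 / 2"
    using UDLO_dense_interval_family[OF assms(1), of m] by blast
  let ?D = "interval_complement (\<Union>n. S n)"
  have "\<not> compact ?D"
    using UDLO_interval_complement_not_compact[OF assms(1) S(2,5)] .
  moreover have "interior ?D = {}"
  proof (rule UDLO_interior_interval_complement[OF assms(1) S(2)])
    have "C \<subseteq> (\<Union>(a, b)\<in>\<Union>n. S n. {a..b})"
      using S(3) m by blast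
    then show "closure (\<Union>(a, b)\<in>\<Union>n. S n. {a..b}) = UNIV"
      using C(2) closure_mono by blast
  qed
  moreover have "definable_set ?D"
  proof (rule definable_set_interval_complement
      [OF UDLO_metric_linear_order[OF assms(1)] S(1,2) refl])
    \<comment> \<open>The empty set is compact, so non-compactness also yields nonemptiness.\<close>
    show "?D \<noteq> {}"
      using \<open>\<not> compact ?D\<close> by auto
    show "dist a b \<le> 1 / Suc n" if "(a, b) \<in> (\<Union>n. S n) - S n" for n a b
      using S(4)[OF that] by simp
  qed
  ultimately show ?thesis
    by blast
qed

end
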